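(* Let $T=(V,E)$ be a finite weighted tree whose edges are indexed in order of descending weight (ties broken by a fixed total order), let $E_c\subseteq E$, and let $T_c=(V_c,E_c)$ be the tree obtained from $T$ by contracting all edges in $E\setminus E_c$. Then $T_c$ is a dendrogram lineage preserving tree contraction of $T$ if and only if for every pair of edges $e_i,e_j\in E_c$, the lowest common dendrogram ancestor $\mathrm{LCDA}_T(e_i,e_j)$ of $e_i$ and $e_j$ in the dendrogram of $T$ also belongs to $E_c$.
   Context: Edge order: the edges of the tree $T$ are sorted by weight in descending order, with ties broken in a fixed consistent way, so each edge has a distinct index, and a smaller index means a heavier edge. Contraction: $T_c$ is obtained by, for each edge $(u,v)\in E\setminus E_c$, merging its endpoints into a single supervertex which inherits all neighbours of $u$ and $v$ (other than $u,v$). The edge set of $T_c$ is $E_c$, and its edges keep their weights and relative order from $T$. Dendrogram of a tree (top-down definition): the root is the heaviest (smallest-index) edge of the tree. Removing it splits the tree into two connected components; for each component containing at least one edge, the heaviest edge of that component is a child of the removed edge (a component consisting of a single vertex $v$ contributes the leaf node $v$ as a child). The procedure is applied recursively to each component. $P(e)$ denotes the parent of the edge $e$ in the dendrogram. Ancestors: the ancestors of $e$ are $e,P(e),P^2(e),\dots,P^k(e)$ where $P^k(e)$ is the dendrogram root; each edge is an ancestor of itself. $\mathrm{LCDA}_T(e_i,e_j)$ is the deepest edge in the dendrogram of $T$ that is an ancestor of both $e_i$ and $e_j$. Dendrogram lineage preserving tree contraction: a contraction $T_c=(V_c,E_c)$ of $T$ such that for any two edges $e_i,e_j\in E_c$,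 $e_i$ is an ancestor of $e_j$ in the dendrogram of $T_c$ if and only if $e_i$ is an ancestor of $e_j$ in the dendrogram of $T$. *)

theory Defs
  imports Complex_Main
begin

text \<open>Edges have their own type and an endpoint map, so that an edge keeps its identity when
  the vertices it joins are merged by a contraction. A smaller \<open>index\<close> means a heavier edge.\<close>

record ('v, 'e) wgraph =
  verts :: "'v set"
  edges :: "'e set"
  ends :: "'e \<Rightarrow> 'v set"
  weight :: "'e \<Rightarrow> real"
  index :: "'e \<Rightarrow> nat"

definition wf_graph :: "('v, 'e) wgraph \<Rightarrow> bool" where
  "wf_graph G \<longleftrightarrow> finite (verts G) \<and> finite (edges G) \<and>
     (\<forall>e\<in>edges G. ends G e \<subseteq> verts G \<and> card (ends G e) = 2)"

definition adj :: "('v, 'e) wgraph \<Rightarrow> ('v \<times> 'v) set" where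
  "adj G = {(u, v). \<exists>e\<in>edges G. ends G e = {u, v}}"

definition connected_graph :: "('v, 'e) wgraph \<Rightarrow> bool" where
  "connected_graph G \<longleftrightarrow> verts G \<noteq> {} \<and> (\<forall>u\<in>verts G. \<forall>v\<in>verts G. (u, v) \<in> (adj G)\<^sup>*)"

text \<open>A walk from \<open>u\<close> to \<open>v\<close> is the list of its steps: the edge taken and the vertex reached.\<close>

fun walk :: "('v, 'e) wgraph \<Rightarrow> 'v \<Rightarrow> ('e \<times> 'v) list \<Rightarrow> 'v \<Rightarrow> bool" where
  "walk G u [] v \<longleftrightarrow> u \<in> verts G \<and> u = v"
| "walk G u ((e, x) # p) v \<longleftrightarrow> e \<in> edges G \<and> ends G e = {u, x} \<and> walk G x p v"

definition cycle :: "('v, 'e) wgraph \<Rightarrow> 'v \<Rightarrow> ('e \<times> 'v) list \<Rightarrow> bool" where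
  "cycle G u p \<longleftrightarrow> p \<noteq> [] \<and> walk G u p u \<and> distinct (map fst p) \<and> distinct (map snd p)"

definition tree :: "('v, 'e) wgraph \<Rightarrow> bool" where
  "tree G \<longleftrightarrow> wf_graph G \<and> connected_graph G \<and> (\<nexists>u p. cycle G u p)"

text \<open>The index lists the edges by descending weight; being injective, it also fixes how
  edges of equal weight are ordered. Indices need not be consecutive, so that the edges of a
  contraction can keep theirs.\<close>

definition descending_index :: "('v, 'e) wgraph \<Rightarrow> bool" where
  "descending_index G \<longleftrightarrow> inj_on (index G) (edges G) \<and>
     (\<forall>e\<in>edges G. \<forall>f\<in>edges G. weight G f < weight G e \<longrightarrow> index G e < index G f)"

definition weighted_tree :: "('v, 'e) wgraph \<Rightarrow> bool" where
  "weighted_tree G \<longleftrightarrow> tree G \<and> descending_index G"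

text \<open>Contracting all edges outside \<open>F\<close>: a supervertex is a class of the equivalence relation
  on vertices generated by identifying the endpoints of each edge outside \<open>F\<close>.\<close>

definition merged :: "('v, 'e) wgraph \<Rightarrow> 'e set \<Rightarrow> ('v \<times> 'v) set" where
  "merged G F = (adj (G\<lparr>edges := edges G - F\<rparr>))\<^sup>* \<inter> verts G \<times> verts G"

definition contraction :: "('v, 'e) wgraph \<Rightarrow> 'e set \<Rightarrow> ('v set, 'e) wgraph" where
  "contraction G F =
     \<lparr>verts = verts G // merged G F,
      edges = F,
      ends = (\<lambda>e. (\<lambda>v. merged G F `` {v}) ` ends G e),
      weight = weight G,
      index = index G\<rparr>"

definition induced :: "('v, 'e) wgraph \<Rightarrow> 'v set \<Rightarrow> ('v, 'e) wgraph" where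
  "induced G U = G\<lparr>verts := U, edges := {e \<in> edges G. ends G e \<subseteq> U}\<rparr>"

definition components :: "('v, 'e) wgraph \<Rightarrow> ('v, 'e) wgraph set" where
  "components G = (\<lambda>v. induced G {u \<in> verts G. (v, u) \<in> (adj G)\<^sup>*}) ` verts G"

definition heaviest :: "('v, 'e) wgraph \<Rightarrow> 'e" where
  "heaviest G = (ARG_MIN (index G) e. e \<in> edges G)"

definition split :: "('v, 'e) wgraph \<Rightarrow> ('v, 'e) wgraph set" where
  "split G = components (G\<lparr>edges := edges G - {heaviest G}\<rparr>)"

text \<open>The subtrees handled by the recursive top-down construction of the dendrogram.\<close>

inductive_set subproblems :: "('v, 'e) wgraph \<Rightarrow> ('v, 'e) wgraph set"
  for G :: "('v, 'e) wgraph" where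
  whole: "G \<in> subproblems G"
| part: "C \<in> subproblems G \<Longrightarrow> edges C \<noteq> {} \<Longrightarrow> D \<in> split C \<Longrightarrow> D \<in> subproblems G"

datatype ('v, 'e) dnode = Inner 'e | Leaf 'v

text \<open>The root of the dendrogram of \<open>G\<close>; a subproblem without edges is a single vertex.\<close>

definition droot :: "('v, 'e) wgraph \<Rightarrow> ('v, 'e) dnode" where
  "droot G = (if edges G \<noteq> {} then Inner (heaviest G) else Leaf (the_elem (verts G)))"

text \<open>The dendrogram, as its set of (parent, child) pairs.\<close>

definition dendrogram :: "('v, 'e) wgraph \<Rightarrow> (('v, 'e) dnode \<times> ('v, 'e) dnode) set" where
  "dendrogram G =
     {(droot C, droot D) | C D. C \<in> subproblems G \<and> edges C \<noteq> {} \<and> D \<in> split C}"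

definition ancestor :: "('v, 'e) wgraph \<Rightarrow> 'e \<Rightarrow> 'e \<Rightarrow> bool" where
  "ancestor G a e \<longleftrightarrow> a \<in> edges G \<and> e \<in> edges G \<and> (Inner a, Inner e) \<in> (dendrogram G)\<^sup>*"

definition depth :: "('v, 'e) wgraph \<Rightarrow> 'e \<Rightarrow> nat" where
  "depth G e = (THE k. (droot G, Inner e) \<in> dendrogram G ^^ k)"

definition LCDA :: "('v, 'e) wgraph \<Rightarrow> 'e \<Rightarrow> 'e \<Rightarrow> 'e" where
  "LCDA G e f = (ARG_MAX (depth G) a. ancestor G a e \<and> ancestor G a f)"

definition lineage_preserving_contraction ::
    "('v, 'e) wgraph \<Rightarrow> ('v set, 'e) wgraph \<Rightarrow> bool" where
  "lineage_preserving_contraction G H \<longleftrightarrow>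
     (\<exists>F \<subseteq> edges G. H = contraction G F) \<and>
     (\<forall>e\<in>edges H. \<forall>f\<in>edges H. ancestor H e f \<longleftrightarrow> ancestor G e f)"

end

theory Submission
  imports Defs
begin

text \<open>An edge \<open>a\<close> is an ancestor of \<open>e\<close> exactly if \<open>e\<close> is connected to \<open>a\<close> by edges of index at
  least that of \<open>a\<close>. The same holds in the contraction, where connectedness by a set of edges
  means connectedness in the tree by these edges together with the contracted ones. Hence
  ancestors in the tree remain ancestors in the contraction, and only the converse is at stake.

  If lineage is preserved, let \<open>c\<close> be the lowest common ancestor of \<open>e\<close> and \<open>f\<close>. They are connected
  by edges of index at least that of \<open>c\<close>, so the contraction has a common ancestor \<open>d\<close> whose index
  is no smaller; \<open>d\<close> is then a common ancestor in the tree, which forces \<open>d = c\<close>.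
  Conversely, if \<open>a\<close> is an ancestor of \<open>e\<close> in the contraction only, their lowest common ancestor \<open>c\<close>
  in the tree is a bridge separating them. If \<open>c\<close> is kept, the connection witnessed by the
  contraction avoids \<open>c\<close>, as \<open>c\<close> is heavier than \<open>a\<close>: a contradiction.\<close>

section \<open>Connectedness by a set of edges\<close>

definition reach :: "('e \<Rightarrow> 'v set) \<Rightarrow> 'e set \<Rightarrow> ('v \<times> 'v) set" where
  "reach en F = {(u, v). \<exists>e\<in>F. en e = {u, v}}\<^sup>*"

text \<open>The link to the given definitions. Since \<open>reach\<close> takes the endpoint map and
  the edge set separately, one graph can be examined through many edge sets without building
  subgraphs.\<close>

lemma adj_rtrancl: "(adj G)\<^sup>* = reach (ends G) (edges G)"
  by (simp add: adj_def reach_def)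

lemma reach_refl [simp]: "(u, u) \<in> reach en F"
  by (simp add: reach_def)

lemma reach_trans: "(u, v) \<in> reach en F \<Longrightarrow> (v, w) \<in> reach en F \<Longrightarrow> (u, w) \<in> reach en F"
  unfolding reach_def by (rule rtrancl_trans)

lemma reach_sym: "(u, v) \<in> reach en F \<Longrightarrow> (v, u) \<in> reach en F"
proof -
  have "sym {(u, v). \<exists>e\<in>F. en e = {u, v}}"
    by (auto simp: sym_def insert_commute)
  then show "(u, v) \<in> reach en F \<Longrightarrow> (v, u) \<in> reach en F"
    unfolding reach_def by (meson sym_rtrancl symD)
qed

lemma reach_mono: "(u, v) \<in> reach en F \<Longrightarrow> F \<subseteq> F' \<Longrightarrow> (u, v) \<in> reach en F'"
  unfolding reach_def by (erule rtrancl_mono[THEN subsetD, rotated]) auto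

lemma reach_edge: "e \<in> F \<Longrightarrow> en e = {u, v} \<Longrightarrow> (u, v) \<in> reach en F"
  unfolding reach_def by auto

lemma reach_step:
  "(u, v) \<in> reach en F \<Longrightarrow> e \<in> F \<Longrightarrow> en e = {v, w} \<Longrightarrow> (u, w) \<in> reach en F"
  by (blast intro: reach_trans reach_edge)

lemma reach_induct [consumes 1, case_names refl step]:
  assumes "(u, v) \<in> reach en F" "P u"
    and "\<And>y z e. (u, y) \<in> reach en F \<Longrightarrow> e \<in> F \<Longrightarrow> en e = {y, z} \<Longrightarrow> P y \<Longrightarrow> P z"
  shows "P v"
  using assms(1)[unfolded reach_def]
proof (induction rule: rtrancl_induct)
  case base
  show ?case by fact
next
  case (step y z)
  then show ?case using assms(3)[of y _ z] by (auto simp: reach_def)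
qed

text \<open>Follow a walk from \<open>u\<close> up to its first passage through \<open>c\<close>:
  this initial part avoids \<open>c\<close> and stops at an end of \<open>c\<close>.\<close>

lemma reach_remove_edge:
  assumes "(u, v) \<in> reach en F" "en c = {x, y}"
  shows "(u, v) \<in> reach en (F - {c}) \<or> (u, x) \<in> reach en (F - {c}) \<or> (u, y) \<in> reach en (F - {c})"
  using assms(1)
proof (induction rule: reach_induct)
  case refl
  show ?case by simp
next
  case (step v w e)
  show ?case
  proof (cases "e = c")
    case True
    then show ?thesis using step assms(2) by (auto simp: doubleton_eq_iff)
  next
    case False
    then have "(v, w) \<in> reach en (F - {c})"
      using step by (auto intro: reach_edge)
    then show ?thesis using step.IH by (blast intro: reach_trans)
  qed
qed

lemma heaviest_edge:
  assumes "e \<in> edges G"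
  shows "heaviest G \<in> edges G" "index G (heaviest G) \<le> index G e"
  using arg_min_nat_lemma[of "\<lambda>e. e \<in> edges G" e "index G"] assms
  unfolding heaviest_def by auto

text \<open>Contractions of a tree are handled alongside the tree itself; acyclicity and the
  absence of loops play no role for the structure of the dendrogram.\<close>

locale indexed_graph =
  fixes G :: "('v, 'e) wgraph"
  assumes finite_edges: "finite (edges G)"
    and ends_pair: "e \<in> edges G \<Longrightarrow> \<exists>x y. ends G e = {x, y}"
    and ends_verts: "e \<in> edges G \<Longrightarrow> ends G e \<subseteq> verts G"
    and inj_index: "inj_on (index G) (edges G)"
    and connected: "u \<in> verts G \<Longrightarrow> v \<in> verts G \<Longrightarrow> (u, v) \<in> reach (ends G) (edges G)"
begin

section \<open>Ancestry described by connectedness\<close>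

definition light :: "nat \<Rightarrow> 'e set" where
  "light k = {e \<in> edges G. k \<le> index G e}"

text \<open>Ancestry expressed without the dendrogram; \<open>ancestor_iff_below\<close> proves the
  agreement.\<close>

definition below :: "'e \<Rightarrow> 'e \<Rightarrow> bool" where
  "below a e \<longleftrightarrow> a \<in> edges G \<and> e \<in> edges G \<and> index G a \<le> index G e \<and>
     ends G a \<times> ends G e \<subseteq> reach (ends G) (light (index G a))"

text \<open>An invariant of all subproblems; its last clause says that a subproblem absorbs every
  edge touching it that is lighter than one of its own edges.\<close>

definition region :: "('v, 'e) wgraph \<Rightarrow> bool" where
  "region C \<longleftrightarrow> ends C = ends G \<and> index C = index G \<and> edges C \<subseteq> edges G \<and>
     (\<forall>e\<in>edges C. ends G e \<subseteq> verts C) \<and>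
     (\<forall>u\<in>verts C. \<forall>v\<in>verts C. (u, v) \<in> reach (ends G) (edges C)) \<and>
     (\<forall>e\<in>edges C. \<forall>f\<in>edges G. index G e \<le> index G f \<longrightarrow> ends G f \<inter> verts C \<noteq> {} \<longrightarrow>
        f \<in> edges C)"

lemma index_eqD: "a \<in> edges G \<Longrightarrow> e \<in> edges G \<Longrightarrow> index G a = index G e \<Longrightarrow> a = e"
  using inj_index by (auto dest: inj_onD)

lemma ends_nonempty: "e \<in> edges G \<Longrightarrow> \<exists>x. x \<in> ends G e"
  using ends_pair by blast

lemma ends_reach:
  assumes "e \<in> F" "F \<subseteq> edges G" "x \<in> ends G e" "y \<in> ends G e"
  shows "(x, y) \<in> reach (ends G) F"
proof -
  obtain u v where "ends G e = {u, v}" using ends_pair assms by blast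
  then show ?thesis
    using assms reach_edge[of e F "ends G" u v] reach_sym[of u v "ends G" F] by auto
qed

lemma light_subset: "light k \<subseteq> edges G"
  by (auto simp: light_def)

text \<open>Both edges lie in \<open>light (index G a)\<close>, so one can pass freely between the
  ends of each, and a single connected pair of ends suffices.\<close>

lemma belowI:
  assumes "a \<in> edges G" "e \<in> edges G" "index G a \<le> index G e"
    and "x \<in> ends G a" "y \<in> ends G e" "(x, y) \<in> reach (ends G) (light (index G a))"
  shows "below a e"
proof -
  have "(u, v) \<in> reach (ends G) (light (index G a))" if "u \<in> ends G a" "v \<in> ends G e" for u v
  proof -
    have "(u, x) \<in> reach (ends G) (light (index G a))"
      using that assms by (intro ends_reach[of a]) (auto simp: light_def)
    moreover have "(y, v) \<in> reach (ends G) (light (index G a))"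
      using that assms by (intro ends_reach[of e]) (auto simp: light_def)
    ultimately show ?thesis using assms(6) by (blast intro: reach_trans)
  qed
  then show ?thesis using assms unfolding below_def by auto
qed

lemma below_reach:
  "below a e \<Longrightarrow> x \<in> ends G a \<Longrightarrow> y \<in> ends G e \<Longrightarrow> k \<le> index G a \<Longrightarrow>
    (x, y) \<in> reach (ends G) (light k)"
  by (rule reach_mono[of _ _ _ "light (index G a)"]) (auto simp: below_def light_def)

lemma belowD: "below a e \<Longrightarrow> a \<in> edges G \<and> e \<in> edges G \<and> index G a \<le> index G e"
  by (simp add: below_def)

lemma below_refl: "e \<in> edges G \<Longrightarrow> below e e"
  using ends_nonempty by (blast intro: belowI[of e e] reach_refl)

lemma below_trans:
  assumes "below a b" "below b c"
  shows "below a c"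
proof -
  obtain x y z where "x \<in> ends G a" "y \<in> ends G b" "z \<in> ends G c"
    using assms ends_nonempty belowD by meson
  moreover from this have "(x, z) \<in> reach (ends G) (light (index G a))"
    using below_reach[OF assms(1), of x y] below_reach[OF assms(2), of y z] assms
    by (auto dest: belowD intro: reach_trans)
  ultimately show ?thesis using assms by (auto intro!: belowI[of a c x z] dest!: belowD)
qed

lemma below_antisym: "below a b \<Longrightarrow> below b a \<Longrightarrow> a = b"
  by (auto dest!: belowD intro: index_eqD)

text \<open>The two connections to \<open>e\<close> compose through \<open>e\<close>, and neither
  uses an edge heavier than \<open>a\<close>. Hence the ancestors of an edge form a chain.\<close>

lemma below_linear:
  assumes "below a e" "below b e" "index G a \<le> index G b"
  shows "below a b"
proof -
  obtain x y z where xyz: "x \<in> ends G a" "y \<in> ends G b" "z \<in> ends G e"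
    using assms ends_nonempty belowD by meson
  then have "(x, z) \<in> reach (ends G) (light (index G a))"
    "(y, z) \<in> reach (ends G) (light (index G a))"
    using assms below_reach by auto
  then have "(x, y) \<in> reach (ends G) (light (index G a))"
    by (blast intro: reach_trans reach_sym)
  then show ?thesis using assms xyz by (auto intro!: belowI[of a b x y] dest!: belowD)
qed

text \<open>The common ancestor is the heaviest edge \<open>d\<close> in the component of
  \<open>x\<close> formed by the edges \<open>light k\<close>. Walks from \<open>x\<close> along
  these edges meet only edges of that component, hence none heavier than \<open>d\<close>.\<close>

lemma common_below:
  assumes "e \<in> light k" "f \<in> light k" "x \<in> ends G e" "y \<in> ends G f"
    and "(x, y) \<in> reach (ends G) (light k)"
  shows "\<exists>d. below d e \<and> below d f \<and> k \<le> index G d"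
proof -
  define S where "S = {d \<in> light k. \<forall>z\<in>ends G d. (x, z) \<in> reach (ends G) (light k)}"
  have S_I: "d \<in> S" if "d \<in> light k" "z \<in> ends G d" "(x, z) \<in> reach (ends G) (light k)" for d z
    using that(1) reach_trans[OF that(3) ends_reach[OF that(1) light_subset that(2)]]
    by (simp add: S_def)
  have e: "e \<in> S" and f: "f \<in> S"
    using S_I[OF assms(1,3) reach_refl] S_I[OF assms(2,4,5)] .
  define d where "d = (ARG_MIN (index G) d. d \<in> S)"
  have d: "d \<in> S" and d_min: "\<And>c. c \<in> S \<Longrightarrow> index G d \<le> index G c"
    using arg_min_nat_lemma[of "\<lambda>d. d \<in> S" e "index G"] e unfolding d_def by auto
  have reach_d: "(x, v) \<in> reach (ends G) (light (index G d))"
    if "(x, v) \<in> reach (ends G) (light k)" for v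
    using that
  proof (induction rule: reach_induct)
    case refl
    show ?case by simp
  next
    case (step v w c)
    then have "c \<in> S" by (auto intro!: S_I[of c v])
    then have "c \<in> light (index G d)" using d_min step(2) by (auto simp: light_def)
    then show ?case using step reach_step by metis
  qed
  have "below d c" if "c \<in> S" for c
  proof -
    have "d \<in> edges G" "c \<in> edges G"
      using that d by (auto simp: S_def light_def)
    then obtain u v where uv: "u \<in> ends G d" "v \<in> ends G c"
      using ends_nonempty by meson
    then have "(x, u) \<in> reach (ends G) (light (index G d))"
      "(x, v) \<in> reach (ends G) (light (index G d))"
      using that d reach_d unfolding S_def by blast+
    then have "(u, v) \<in> reach (ends G) (light (index G d))"
      by (blast intro: reach_trans reach_sym)
    then show ?thesis
      using uv d that d_min by (intro belowI[of d c u v]) (auto simp: S_def light_def)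
  qed
  then show ?thesis using e f d by (auto simp: S_def light_def)
qed

section \<open>Subproblems as regions\<close>

lemma region_edgeD: "region C \<Longrightarrow> e \<in> edges C \<Longrightarrow> e \<in> edges G \<and> ends G e \<subseteq> verts C"
  unfolding region_def by blast

lemma region_closed:
  assumes "region C" "e \<in> edges C" "f \<in> edges G" "index G e \<le> index G f"
    and "z \<in> ends G f" "z \<in> verts C"
  shows "f \<in> edges C"
proof -
  have "ends G f \<inter> verts C \<noteq> {}" using assms(5,6) by blast
  then show ?thesis using assms(1-4) unfolding region_def by blast
qed

text \<open>A walk starting in the region cannot leave it: each of its edges touches the region and
  is no heavier than \<open>a\<close>, so it is absorbed.\<close>

lemma region_reach_closed:
  assumes "region C" "a \<in> edges C" "x \<in> verts C" "(x, y) \<in> reach (ends G) (light (index G a))"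
  shows "y \<in> verts C"
  using assms(4)
proof (induction rule: reach_induct)
  case refl
  show ?case by fact
next
  case (step y z f)
  then have "f \<in> edges C"
    using region_closed[OF assms(1,2), of f y] by (simp add: light_def)
  then show ?case using step region_edgeD[OF assms(1), of f] by auto
qed

lemma region_heaviest:
  assumes "region C" "edges C \<noteq> {}"
  shows "heaviest C \<in> edges C" "e \<in> edges C \<Longrightarrow> index G (heaviest C) \<le> index G e"
proof -
  have "index C = index G" using assms by (simp add: region_def)
  then show "heaviest C \<in> edges C" "e \<in> edges C \<Longrightarrow> index G (heaviest C) \<le> index G e"
    using heaviest_edge[of _ C] assms(2) by fastforce+
qed

text \<open>Splitting deletes only the heaviest edge. An edge that touches a part and is no heavier
  than one of its edges was absorbed by \<open>C\<close>, survives the deletion, and so belongs to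
  the part.\<close>

lemma region_split:
  assumes C: "region C" "edges C \<noteq> {}" and D: "D \<in> split C"
  shows "region D" "edges D \<subseteq> edges C - {heaviest C}" "verts D \<noteq> {}"
proof -
  define E where "E = edges C - {heaviest C}"
  have en: "ends C = ends G" "index C = index G" using C by (auto simp: region_def)
  obtain v where v: "v \<in> verts C"
    and D_eq: "D = induced (C\<lparr>edges := E\<rparr>) {u \<in> verts C. (v, u) \<in> reach (ends G) E}"
    using D unfolding split_def components_def by (auto simp: adj_rtrancl E_def en)
  have E_C: "E \<subseteq> edges C" by (auto simp: E_def)
  have E_G: "E \<subseteq> edges G" using C E_C by (auto simp: region_def)
  have edges_D: "edges D = {e \<in> E. ends G e \<subseteq> verts D}"
    and verts_D: "verts D = {u \<in> verts C. (v, u) \<in> reach (ends G) E}"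
    and same_D: "ends D = ends G" "index D = index G"
    by (auto simp: D_eq induced_def en)
  show sub: "edges D \<subseteq> edges C - {heaviest C}" using edges_D E_def by auto
  show "verts D \<noteq> {}" using v verts_D by auto
  \<comment> \<open>A part is a full component, so a surviving edge with one end in it has both ends
    in it.\<close>
  have touch: "e \<in> edges D" if "e \<in> E" "z \<in> ends G e" "z \<in> verts D" for e z
  proof -
    have "ends G e \<subseteq> verts C" using that C E_C by (auto simp: region_def)
    moreover have "(v, z) \<in> reach (ends G) E" using that(3) verts_D by simp
    moreover have "(z, w) \<in> reach (ends G) E" if "w \<in> ends G e" for w
      using \<open>e \<in> E\<close> \<open>z \<in> ends G e\<close> that E_G by (intro ends_reach[of e])
    ultimately show ?thesis using that(1) reach_trans[of v z "ends G" E]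
      unfolding edges_D verts_D by blast
  qed
  \<comment> \<open>A walk along surviving edges from \<open>v\<close> stays in the component, so
    its edges are edges of \<open>D\<close>; this makes \<open>D\<close> connected by its own
    edges.\<close>
  have reach_D: "u \<in> verts D \<and> (v, u) \<in> reach (ends G) (edges D)"
    if "(v, u) \<in> reach (ends G) E" for u
    using that
  proof (induction rule: reach_induct)
    case refl
    show ?case using v verts_D by simp
  next
    case (step y z e)
    then have "e \<in> edges D" using touch by blast
    then show ?case using step edges_D reach_step[of v y "ends G" "edges D" e z] by auto
  qed
  have "f \<in> edges D"
    if "e \<in> edges D" "f \<in> edges G" "index G e \<le> index G f" "z \<in> ends G f" "z \<in> verts D" for e f z
  proof -
    have "e \<in> edges C" "e \<noteq> heaviest C" using that sub by auto
    \<comment> \<open>Strictness, obtained from injectivity of the index, is what rules out that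
      \<open>f\<close> is the deleted edge.\<close>
    then have "index G (heaviest C) < index G e"
      using region_heaviest[OF C] region_edgeD[OF C(1)] index_eqD[of "heaviest C" e]
      by (metis nat_less_le)
    moreover have "f \<in> edges C"
      using region_closed[OF C(1) \<open>e \<in> edges C\<close> that(2,3,4)] that(5) verts_D by simp
    ultimately have "f \<in> E" using that by (auto simp: E_def)
    then show ?thesis using touch that(4,5) by blast
  qed
  moreover have "(u, w) \<in> reach (ends G) (edges D)" if "u \<in> verts D" "w \<in> verts D" for u w
  proof -
    have "(v, u) \<in> reach (ends G) (edges D)" "(v, w) \<in> reach (ends G) (edges D)"
      using that reach_D verts_D by auto
    then show ?thesis by (blast intro: reach_trans reach_sym)
  qed
  moreover have "\<forall>e\<in>edges D. ends G e \<subseteq> verts D" "edges D \<subseteq> edges G"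
    using edges_D E_G by auto
  ultimately show "region D" using same_D unfolding region_def by blast
qed

lemma region_subproblem: "C \<in> subproblems G \<Longrightarrow> region C"
proof (induction rule: subproblems.induct)
  case whole
  show ?case using ends_verts connected by (auto simp: region_def)
next
  case (part C D)
  then show ?case using region_split by blast
qed

text \<open>A region is connected by its own edges, none heavier than its root; conversely, walks
  along edges no heavier than the root cannot leave it. So the root alone determines the edges of a
  subproblem.\<close>

lemma region_edges_below:
  assumes "region C" "edges C \<noteq> {}"
  shows "e \<in> edges C \<longleftrightarrow> below (heaviest C) e"
proof -
  let ?a = "heaviest C"
  note h = region_heaviest[OF assms]
  obtain x where x: "x \<in> ends G ?a" "x \<in> verts C"
    using ends_nonempty[of ?a] region_edgeD[OF assms(1) h(1)] by blast
  have sub: "edges C \<subseteq> light (index G ?a)" using h assms by (auto simp: light_def region_def)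
  show ?thesis
  proof
    assume e: "e \<in> edges C"
    then obtain y where y: "y \<in> ends G e" "y \<in> verts C"
      using ends_nonempty[of e] region_edgeD[OF assms(1) e] by blast
    then have "(x, y) \<in> reach (ends G) (edges C)" using x assms by (auto simp: region_def)
    then show "below ?a e"
      using x(1) y(1) e h sub light_subset
      by (intro belowI[of ?a e x y]) (auto intro: reach_mono[OF _ sub])
  next
    assume b: "below ?a e"
    then obtain y where y: "y \<in> ends G e" using ends_nonempty belowD by meson
    have "(x, y) \<in> reach (ends G) (light (index G ?a))" using below_reach[OF b x(1) y] by simp
    then have "y \<in> verts C" by (rule region_reach_closed[OF assms(1) h(1) x(2)])
    then show "e \<in> edges C" using region_closed[OF assms(1) h(1) _ _ y] belowD[OF b] by blast
  qed
qed

lemma edge_in_split: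
  assumes "region C" "e \<in> edges C" "e \<noteq> heaviest C"
  shows "\<exists>D\<in>split C. e \<in> edges D"
proof -
  define E where "E = edges C - {heaviest C}"
  have en: "ends C = ends G" using assms by (auto simp: region_def)
  obtain v where v: "v \<in> ends G e" using assms ends_nonempty[of e] by (auto simp: region_def)
  have "e \<in> E" "E \<subseteq> edges G" using assms by (auto simp: region_def E_def)
  then have "ends G e \<subseteq> {u \<in> verts C. (v, u) \<in> reach (ends G) E}"
    using region_edgeD[OF assms(1,2)] v ends_reach[of e E v] by auto
  then have "e \<in> edges (induced (C\<lparr>edges := E\<rparr>) {u \<in> verts C. (v, u) \<in> reach (ends G) E})"
    using assms by (auto simp: induced_def E_def en)
  moreover have "induced (C\<lparr>edges := E\<rparr>) {u \<in> verts C. (v, u) \<in> reach (ends G) E} \<in> split C"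
    using v region_edgeD[OF assms(1,2)]
    by (auto simp: split_def components_def adj_rtrancl E_def en)
  ultimately show ?thesis by blast
qed

section \<open>The dendrogram and its ancestor relation\<close>

lemma dendrogram_reaches:
  assumes "C \<in> subproblems G" "e \<in> edges C"
  shows "(droot C, Inner e) \<in> (dendrogram G)\<^sup>* \<and> (\<exists>D\<in>subproblems G. e \<in> edges D \<and> heaviest D = e)"
  using assms
proof (induction "card (edges C)" arbitrary: C rule: less_induct)
  case less
  note C = region_subproblem[OF less(2)]
  have ne: "edges C \<noteq> {}" using less by auto
  show ?case
  \<comment> \<open>Descend into the part containing \<open>e\<close>, which has fewer edges, until
    \<open>e\<close> itself is the root.\<close>
  proof (cases "e = heaviest C")
    case True
    then show ?thesis using less ne by (auto simp: droot_def)
  next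
    case False
    then obtain D where D: "D \<in> split C" "e \<in> edges D" using edge_in_split C less by blast
    have D_sub: "D \<in> subproblems G" using less ne D subproblems.part by blast
    have "edges D \<subset> edges C"
      using region_split(2)[OF C ne D(1)] region_heaviest(1)[OF C ne] by auto
    moreover have "finite (edges C)"
      using C finite_edges by (auto simp: region_def intro: finite_subset)
    ultimately have "card (edges D) < card (edges C)" by (rule psubset_card_mono[rotated])
    note IH = less(1)[OF this D_sub D(2)]
    have "(droot C, droot D) \<in> dendrogram G" using less ne D unfolding dendrogram_def by blast
    then show ?thesis using IH by (blast intro: converse_rtrancl_into_rtrancl)
  qed
qed

lemma edge_subproblem:
  assumes "e \<in> edges G"
  obtains C where "C \<in> subproblems G" "edges C \<noteq> {}" "heaviest C = e"
  using dendrogram_reaches[OF subproblems.whole assms] by blast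

text \<open>Let \<open>C\<close> be the subproblem that was split and \<open>D\<close> its part
  rooted at \<open>e\<close>. An ancestor \<open>b\<close> of \<open>e\<close> lighter than the root
  of \<open>C\<close> would lie in some part, and the connection from \<open>b\<close> would keep
  \<open>e\<close> in the same part. That part is \<open>D\<close>, where nothing is heavier than
  \<open>e\<close>, so \<open>b = e\<close>.\<close>

lemma parentE:
  assumes "(n, Inner e) \<in> dendrogram G"
  obtains a where "n = Inner a" "below a e" "a \<noteq> e"
    "\<And>b. below b e \<Longrightarrow> b \<noteq> e \<Longrightarrow> below b a"
proof -
  obtain C D where CD: "C \<in> subproblems G" "edges C \<noteq> {}" "D \<in> split C"
    "n = droot C" "Inner e = droot D"
    using assms unfolding dendrogram_def by blast
  let ?a = "heaviest C"
  note C = region_subproblem[OF CD(1)]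
  note D = region_split[OF C CD(2,3)]
  have neD: "edges D \<noteq> {}" and e: "e = heaviest D"
    using CD(5) by (auto simp: droot_def split: if_splits)
  have e_in: "e \<in> edges D" using region_heaviest(1)[OF D(1) neD] e by simp
  then have ae: "below ?a e" "?a \<noteq> e"
    using region_edges_below[OF C CD(2)] D(2) by auto
  have "below b ?a" if b: "below b e" "b \<noteq> e" for b
  proof (cases "index G b \<le> index G ?a")
    case True
    then show ?thesis using b ae below_linear by blast
  next
    case False
    then have "below ?a b" using below_linear[OF ae(1) b(1)] by simp
    then have b_C: "b \<in> edges C" using region_edges_below[OF C CD(2)] by blast
    have "b \<noteq> ?a" using False by auto
    then obtain D' where D': "D' \<in> split C" "b \<in> edges D'" using edge_in_split[OF C b_C] by blast
    note rD' = region_split[OF C CD(2) D'(1)]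
    have "e \<in> edges D'"
    proof -
      obtain x y where xy: "x \<in> ends G b" "y \<in> ends G e" using b ends_nonempty belowD by meson
      have "(x, y) \<in> reach (ends G) (light (index G b))" using below_reach b xy by auto
      moreover have "x \<in> verts D'" using region_edgeD[OF rD'(1) D'(2)] xy(1) by blast
      ultimately have "y \<in> verts D'" using region_reach_closed[OF rD'(1) D'(2)] by blast
      then show ?thesis using region_closed[OF rD'(1) D'(2) _ _ xy(2)] belowD[OF b(1)] by blast
    qed
    \<comment> \<open>Both parts contain an end \<open>z\<close> of \<open>e\<close>, and each is
      the component of \<open>z\<close>.\<close>
    have "D' = D"
    proof -
      obtain z where z: "z \<in> ends G e" using belowD[OF b(1)] ends_nonempty by blast
      then have zz: "z \<in> verts D" "z \<in> verts D'"
        using region_edgeD[OF D(1) e_in] region_edgeD[OF rD'(1) \<open>e \<in> edges D'\<close>] by auto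
      define E where "E = edges C - {?a}"
      have en: "ends C = ends G" using C by (auto simp: region_def)
      have *: "B = induced (C\<lparr>edges := E\<rparr>) {u \<in> verts C. (z, u) \<in> reach (ends G) E}"
        if B: "B \<in> split C" "z \<in> verts B" for B
      proof -
        obtain v where v: "B = induced (C\<lparr>edges := E\<rparr>) {u \<in> verts C. (v, u) \<in> reach (ends G) E}"
          using B unfolding split_def components_def by (auto simp: adj_rtrancl E_def en)
        then have "(v, z) \<in> reach (ends G) E" using B(2) by (simp add: induced_def)
        then have "(v, u) \<in> reach (ends G) E \<longleftrightarrow> (z, u) \<in> reach (ends G) E" for u
          by (blast intro: reach_trans reach_sym)
        then show ?thesis using v by simp
      qed
      show ?thesis using *[OF D'(1) zz(2)] *[OF CD(3) zz(1)] by simp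
    qed
    then have "index G e \<le> index G b" using region_heaviest(2)[OF D(1) neD] D'(2) e by simp
    then have False using b belowD[OF b(1)] index_eqD[of b e] by simp
    then show ?thesis ..
  qed
  then show thesis using that[of ?a] CD(2,4) ae by (auto simp: droot_def)
qed

text \<open>Upwards, each parent is \<open>below\<close> its child and transitivity does the rest.
  Downwards, \<open>e\<close> is an edge of the subproblem rooted at \<open>a\<close>, from which
  the descent reaches it.\<close>

lemma ancestor_iff_below: "ancestor G a e \<longleftrightarrow> below a e"
proof
  assume "ancestor G a e"
  then have *: "(Inner a, Inner e) \<in> (dendrogram G)\<^sup>*" "a \<in> edges G" by (auto simp: ancestor_def)
  \<comment> \<open>The induction ranges over all nodes, leaves included; \<open>parentE\<close>
    guarantees that the parent of an inner node is inner, so the hypothesis applies to it.\<close>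
  have "\<forall>e. n = Inner e \<longrightarrow> below a e" if "(Inner a, n) \<in> (dendrogram G)\<^sup>*" for n
    using that
  proof (induction rule: rtrancl_induct)
    case base
    show ?case using below_refl[OF *(2)] by simp
  next
    case (step m n)
    show ?case
    proof (intro allI impI)
      fix e assume "n = Inner e"
      with step(2) have "(m, Inner e) \<in> dendrogram G" by simp
      then obtain b where "m = Inner b" "below b e" by (rule parentE)
      then show "below a e" using step.IH below_trans by blast
    qed
  qed
  then show "below a e" using * by blast
next
  assume b: "below a e"
  then have "a \<in> edges G" using belowD by blast
  then obtain C where C: "C \<in> subproblems G" "edges C \<noteq> {}" "heaviest C = a"
    by (rule edge_subproblem)
  then have "e \<in> edges C" using b region_edges_below[OF region_subproblem[OF C(1)] C(2)] by simp
  then show "ancestor G a e"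
    using dendrogram_reaches[OF C(1), of e] C(2,3) belowD[OF b] by (simp add: ancestor_def droot_def)
qed

section \<open>Depth and lowest common ancestors\<close>

lemma below_root: "e \<in> edges G \<Longrightarrow> below (heaviest G) e"
  using region_edges_below[OF region_subproblem[OF subproblems.whole]] by blast

lemma finite_below: "finite {a. below a e}"
  using finite_edges by (rule finite_subset[rotated]) (auto dest: belowD)

text \<open>By \<open>parentE\<close>, the ancestors of an edge are the edge itself and the
  ancestors of its parent, so each level adds exactly one. The \<open>Suc\<close> accounts for the
  root, which has depth 0 and is its own ancestor.\<close>

lemma depth_eq:
  assumes "e \<in> edges G"
  shows "Suc (depth G e) = card {a. below a e}"
proof -
  have root: "droot G = Inner (heaviest G)" using assms by (auto simp: droot_def)
  have unique: "Suc k = card {a. below a e}" if "(droot G, Inner e) \<in> dendrogram G ^^ k" for k e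
    using that
  proof (induction k arbitrary: e)
    case 0
    then have e: "e = heaviest G" using root by simp
    have "a = e" if "below a e" for a
      using e that below_antisym[OF that] below_root belowD[OF that] by blast
    then have "{a. below a e} = {e}"
      using e below_refl[OF heaviest_edge(1)[OF assms]] by blast
    then show ?case by simp
  next
    case (Suc k)
    then obtain n where n: "(droot G, n) \<in> dendrogram G ^^ k" "(n, Inner e) \<in> dendrogram G"
      by auto
    from n(2) obtain a where a: "n = Inner a" "below a e" "a \<noteq> e"
      "\<And>b. below b e \<Longrightarrow> b \<noteq> e \<Longrightarrow> below b a"
      by (rule parentE) blast
    have "{b. below b e} = insert e {b. below b a}"
      using a(2,4) below_trans[OF _ a(2)] below_refl[of e] belowD[OF a(2)] by blast
    moreover have "e \<notin> {b. below b a}" using a(2,3) below_antisym[of a e] by blast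
    ultimately show ?case using Suc.IH[of a] n a finite_below by simp
  qed
  have "(droot G, Inner e) \<in> (dendrogram G)\<^sup>*"
    using dendrogram_reaches[OF subproblems.whole assms] by blast
  then obtain k where k: "(droot G, Inner e) \<in> dendrogram G ^^ k"
    by (auto dest: rtrancl_imp_relpow)
  \<comment> \<open>Every path length from the root is fixed by the same cardinality, so the
    \<open>THE\<close> in \<open>depth\<close> is well defined.\<close>
  then have "depth G e = k"
    unfolding depth_def using unique by (metis (mono_tags, lifting) Suc_inject the_equality)
  then show ?thesis using unique k by blast
qed

lemma depth_less:
  assumes "below a b" "a \<noteq> b"
  shows "depth G a < depth G b"
proof -
  have "{c. below c a} \<subset> {c. below c b}"
    using below_trans[OF _ assms(1)] below_antisym[OF assms(1)] assms(2) below_refl[of b]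
      belowD[OF assms(1)] by blast
  then have "card {c. below c a} < card {c. below c b}"
    by (rule psubset_card_mono[OF finite_below])
  then show ?thesis using assms depth_eq belowD by (metis Suc_less_SucD)
qed

text \<open>The common ancestors form a chain along which depth strictly increases, so the deepest
  one has all others as ancestors.\<close>

lemma LCDA_below:
  assumes "e \<in> edges G" "f \<in> edges G"
  shows "below (LCDA G e f) e" "below (LCDA G e f) f"
    "\<And>a. below a e \<Longrightarrow> below a f \<Longrightarrow> below a (LCDA G e f)"
proof -
  define P where "P a \<longleftrightarrow> below a e \<and> below a f" for a
  have L: "LCDA G e f = arg_max (depth G) P"
    unfolding LCDA_def ancestor_iff_below P_def ..
  have "P (heaviest G)" using assms below_root by (simp add: P_def)
  \<comment> \<open>A strict bound on the depth of common ancestors, which ensures that the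
    \<open>ARG_MAX\<close> is attained.\<close>
  moreover have "depth G a < Suc (depth G e)" if "P a" for a
    using that depth_less[of a e] unfolding P_def by (cases "a = e") auto
  ultimately have PL: "P (LCDA G e f)" "\<And>a. P a \<Longrightarrow> depth G a \<le> depth G (LCDA G e f)"
    unfolding L using arg_max_nat_lemma[of P "heaviest G" "depth G" "Suc (depth G e)"] by auto
  then show "below (LCDA G e f) e" "below (LCDA G e f) f" by (auto simp: P_def)
  fix a assume a: "below a e" "below a f"
  show "below a (LCDA G e f)"
  proof (cases "index G a \<le> index G (LCDA G e f)")
    case True
    then show ?thesis using a PL(1) below_linear unfolding P_def by blast
  next
    case False
    then have "below (LCDA G e f) a" "LCDA G e f \<noteq> a"
      using a PL(1) below_linear[of "LCDA G e f" e a] unfolding P_def by auto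
    then show ?thesis using depth_less PL(2)[of a] a by (fastforce simp: P_def)
  qed
qed

end

section \<open>Paths and bridges in a tree\<close>

lemma walk_edge_ends:
  "walk G u p v \<Longrightarrow> e \<in> fst ` set p \<Longrightarrow> ends G e \<subseteq> set (u # map snd p)"
  by (induction G u p v rule: walk.induct) auto

text \<open>Vertices and edges are both required to be distinct because \<open>cycle\<close> asks
  for both. Unlike there, the starting vertex counts among the distinct ones.\<close>

definition path_in :: "('v, 'e) wgraph \<Rightarrow> 'e set \<Rightarrow> 'v \<Rightarrow> ('e \<times> 'v) list \<Rightarrow> 'v \<Rightarrow> bool" where
  "path_in G F u p v \<longleftrightarrow> walk G u p v \<and> distinct (u # map snd p) \<and> distinct (map fst p) \<and>
     fst ` set p \<subseteq> F"

lemma path_in_suffix: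
  "path_in G F u p v \<Longrightarrow> w \<in> set (u # map snd p) \<Longrightarrow> \<exists>q. path_in G F w q v"
proof (induction p arbitrary: u)
  case Nil
  then show ?case by auto
next
  case (Cons s p)
  obtain e x where s: "s = (e, x)" by fastforce
  show ?case
  proof (cases "w = u")
    case True
    then show ?thesis using Cons by blast
  next
    case False
    then show ?thesis using Cons s by (intro Cons.IH[of x]) (auto simp: path_in_def)
  qed
qed

text \<open>The path runs backwards because \<open>walk\<close> grows at its start, whereas
  \<open>reach_induct\<close> extends at the far end. A vertex met again is handled by cutting the
  path there.\<close>

lemma reach_path:
  assumes "(v, u) \<in> reach (ends G) F" "F \<subseteq> edges G" "v \<in> verts G"
  shows "\<exists>p. path_in G F u p v"
  using assms(1)
proof (induction rule: reach_induct)
  case refl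
  have "path_in G F v [] v" using assms by (simp add: path_in_def)
  then show ?case ..
next
  case (step y z e)
  then obtain p where p: "path_in G F y p v" by blast
  show ?case
  proof (cases "z \<in> set (y # map snd p)")
    case True
    then show ?thesis using p path_in_suffix by metis
  next
    case False
    \<comment> \<open>An edge already used would have both ends on the path, but \<open>z\<close> is
      not on it.\<close>
    have "e \<notin> fst ` set p"
      using walk_edge_ends[of G y p v e] p step False by (auto simp: path_in_def)
    then have "path_in G F z ((e, y) # p) v"
      using p step False assms(2) by (auto simp: path_in_def insert_commute)
    then show ?thesis ..
  qed
qed

lemma tree_bridge:
  assumes "tree G" "c \<in> edges G" "ends G c = {x, y}"
  shows "(x, y) \<notin> reach (ends G) (edges G - {c})"
proof
  assume r: "(x, y) \<in> reach (ends G) (edges G - {c})"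
  have x: "x \<in> verts G" using assms by (auto simp: tree_def wf_graph_def)
  obtain p where p: "path_in G (edges G - {c}) y p x"
    using reach_path[OF r _ x] by auto
  \<comment> \<open>The bypass of \<open>c\<close> from \<open>y\<close> back to \<open>x\<close> is
    closed up by \<open>c\<close> itself.\<close>
  have "cycle G x ((c, y) # p)"
    using p assms by (auto simp: cycle_def path_in_def)
  then show False using assms by (auto simp: tree_def)
qed

lemma tree_indexed_graph:
  assumes "weighted_tree G"
  shows "indexed_graph G"
proof
  have wf: "wf_graph G" and conn: "connected_graph G" and ix: "descending_index G"
    using assms by (auto simp: weighted_tree_def tree_def)
  show "finite (edges G)" "inj_on (index G) (edges G)"
    using wf ix by (auto simp: wf_graph_def descending_index_def)
  fix e assume "e \<in> edges G"
  then have "ends G e \<subseteq> verts G" "card (ends G e) = 2" using wf by (auto simp: wf_graph_def)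
  then show "\<exists>x y. ends G e = {x, y}" "ends G e \<subseteq> verts G" by (auto simp: card_2_iff)
next
  fix u v assume "u \<in> verts G" "v \<in> verts G"
  then show "(u, v) \<in> reach (ends G) (edges G)"
    using assms
    by (simp add: weighted_tree_def tree_def connected_graph_def adj_rtrancl)
qed

section \<open>Connectedness and ancestry in a contraction\<close>

context indexed_graph
begin

context
  fixes F :: "'e set"
  assumes F: "F \<subseteq> edges G"
begin

abbreviation super :: "'v \<Rightarrow> 'v set" where
  "super v \<equiv> merged G F `` {v}"

lemma merged_eq: "merged G F = reach (ends G) (edges G - F) \<inter> verts G \<times> verts G"
  by (simp add: merged_def adj_rtrancl)

lemma super_eq_iff:
  assumes "u \<in> verts G" "v \<in> verts G"
  shows "super u = super v \<longleftrightarrow> (u, v) \<in> reach (ends G) (edges G - F)"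
proof
  assume "super u = super v"
  moreover have "v \<in> super v" using assms by (simp add: merged_eq)
  ultimately have "v \<in> super u" by simp
  then show "(u, v) \<in> reach (ends G) (edges G - F)" by (simp add: merged_eq)
next
  assume "(u, v) \<in> reach (ends G) (edges G - F)"
  then have "(u, w) \<in> reach (ends G) (edges G - F) \<longleftrightarrow> (v, w) \<in> reach (ends G) (edges G - F)" for w
    by (blast intro: reach_trans reach_sym)
  then show "super u = super v" using assms by (auto simp: merged_eq)
qed

text \<open>An edge of the contraction joins two classes through some representatives, and
  contracted edges connect the representatives of one class.\<close>

lemma contraction_reach_iff:
  assumes "u \<in> verts G" "v \<in> verts G" "F' \<subseteq> F"
  shows "(super u, super v) \<in> reach (ends (contraction G F)) F' \<longleftrightarrow>
    (u, v) \<in> reach (ends G) (F' \<union> (edges G - F))"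
proof
  assume "(super u, super v) \<in> reach (ends (contraction G F)) F'"
  \<comment> \<open>A walk in the contraction determines only the class it arrives in, so the
    induction speaks about all representatives of that class.\<close>
  moreover have "\<forall>w\<in>verts G. super w = Y \<longrightarrow> (u, w) \<in> reach (ends G) (F' \<union> (edges G - F))"
    if "(super u, Y) \<in> reach (ends (contraction G F)) F'" for Y
    using that
  proof (induction rule: reach_induct)
    case refl
    show ?case
    proof (intro ballI impI)
      fix w assume "w \<in> verts G" "super w = super u"
      then have "(u, w) \<in> reach (ends G) (edges G - F)" using super_eq_iff[of u w] assms by simp
      then show "(u, w) \<in> reach (ends G) (F' \<union> (edges G - F))" by (rule reach_mono) auto
    qed
  next
    case (step Y Z e)
    have e: "e \<in> edges G" using step(2) assms(3) F by blast
    obtain x y where xy: "ends G e = {x, y}" using ends_pair[OF e] by blast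
    have "{super x, super y} = {Y, Z}" using step(3) xy by (simp add: contraction_def)
    then obtain y' z' where yz: "ends G e = {y', z'}" "super y' = Y" "super z' = Z"
      using xy by (metis doubleton_eq_iff)
    have in_G: "y' \<in> verts G" "z' \<in> verts G" using yz ends_verts[OF e] by auto
    show ?case
    proof (intro ballI impI)
      fix w assume w: "w \<in> verts G" "super w = Z"
      have "(u, y') \<in> reach (ends G) (F' \<union> (edges G - F))" using step.IH yz in_G by blast
      moreover have "(y', z') \<in> reach (ends G) (F' \<union> (edges G - F))"
        using step(2) yz by (intro reach_edge[of e]) auto
      moreover have "(z', w) \<in> reach (ends G) (edges G - F)"
        using super_eq_iff[of z' w] w yz in_G by simp
      then have "(z', w) \<in> reach (ends G) (F' \<union> (edges G - F))" by (rule reach_mono) auto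
      ultimately show "(u, w) \<in> reach (ends G) (F' \<union> (edges G - F))"
        by (blast intro: reach_trans)
    qed
  qed
  ultimately show "(u, v) \<in> reach (ends G) (F' \<union> (edges G - F))" using assms by blast
next
  assume "(u, v) \<in> reach (ends G) (F' \<union> (edges G - F))"
  then have "v \<in> verts G \<and> (super u, super v) \<in> reach (ends (contraction G F)) F'"
  proof (induction rule: reach_induct)
    case refl
    show ?case using assms by simp
  next
    case (step y z e)
    then have z: "z \<in> verts G" using ends_verts[of e] F assms(3) by auto
    have "(super y, super z) \<in> reach (ends (contraction G F)) F'"
    proof (cases "e \<in> F'")
      case True
      then show ?thesis using step by (intro reach_edge[of e]) (auto simp: contraction_def)
    next
      case False
      then have "super y = super z"
        using step z super_eq_iff[of y z] reach_edge[of e "edges G - F" "ends G" y z] by auto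
      then show ?thesis by simp
    qed
    then show ?case using step z by (blast intro: reach_trans)
  qed
  then show "(super u, super v) \<in> reach (ends (contraction G F)) F'" ..
qed

text \<open>Makes all results on dendrograms available for the contraction.\<close>

lemma indexed_graph_contraction: "indexed_graph (contraction G F)"
proof
  show "finite (edges (contraction G F))"
    using F finite_edges by (auto simp: contraction_def intro: finite_subset)
  show "\<exists>x y. ends (contraction G F) e = {x, y}" if "e \<in> edges (contraction G F)" for e
  proof -
    have "e \<in> edges G" using that F by (auto simp: contraction_def)
    then obtain x y where "ends G e = {x, y}" using ends_pair by blast
    then have "ends (contraction G F) e = {super x, super y}" by (simp add: contraction_def)
    then show ?thesis by blast
  qed
  show "ends (contraction G F) e \<subseteq> verts (contraction G F)"
    if "e \<in> edges (contraction G F)" for e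
    using that F ends_verts by (auto simp: contraction_def intro!: quotientI)
  show "inj_on (index (contraction G F)) (edges (contraction G F))"
    using inj_index F by (auto simp: contraction_def intro: inj_on_subset)
  fix X Y assume "X \<in> verts (contraction G F)" "Y \<in> verts (contraction G F)"
  then obtain u v where uv: "u \<in> verts G" "v \<in> verts G" "X = super u" "Y = super v"
    by (auto simp: contraction_def elim!: quotientE)
  have "F \<union> (edges G - F) = edges G" using F by auto
  then have "(super u, super v) \<in> reach (ends (contraction G F)) F"
    using contraction_reach_iff[of u v F] connected uv by simp
  then show "(X, Y) \<in> reach (ends (contraction G F)) (edges (contraction G F))"
    using uv by (simp add: contraction_def)
qed

lemma contraction_light: "indexed_graph.light (contraction G F) k = F \<inter> light k"
  using F unfolding indexed_graph.light_def[OF indexed_graph_contraction] light_def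
  by (auto simp: contraction_def)

text \<open>Contracted edges enter whatever their weight; a heavy one among them can create a
  lineage that the original graph does not have.\<close>

lemma contraction_belowD:
  assumes "indexed_graph.below (contraction G F) a e" "x \<in> ends G a" "y \<in> ends G e"
  shows "(x, y) \<in> reach (ends G) (F \<inter> light (index G a) \<union> (edges G - F))"
proof -
  have "a \<in> edges G" "e \<in> edges G"
    using indexed_graph.belowD[OF indexed_graph_contraction assms(1)] F
    by (auto simp: contraction_def)
  then have "x \<in> verts G" "y \<in> verts G" using assms ends_verts by auto
  moreover have "(super x, super y) \<in> reach (ends (contraction G F)) (F \<inter> light (index G a))"
    using indexed_graph.below_reach[OF indexed_graph_contraction assms(1),
        of "super x" "super y" "index G a"] assms(2,3)
    by (simp add: contraction_light) (simp add: contraction_def)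
  ultimately show ?thesis using contraction_reach_iff[of x y "F \<inter> light (index G a)"] by simp
qed

lemma contraction_common_below:
  assumes "e \<in> F \<inter> light k" "f \<in> F \<inter> light k" "x \<in> ends G e" "y \<in> ends G f"
    and "(x, y) \<in> reach (ends G) (F \<inter> light k \<union> (edges G - F))"
  shows "\<exists>d\<in>F. indexed_graph.below (contraction G F) d e \<and>
    indexed_graph.below (contraction G F) d f \<and> k \<le> index G d"
proof -
  have "x \<in> verts G" "y \<in> verts G" using assms light_subset ends_verts by blast+
  then have "(super x, super y) \<in> reach (ends (contraction G F)) (F \<inter> light k)"
    using contraction_reach_iff[of x y "F \<inter> light k"] assms(5) by simp
  moreover have "super x \<in> ends (contraction G F) e" "super y \<in> ends (contraction G F) f"
    using assms(3,4) by (auto simp: contraction_def)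
  ultimately obtain d where d: "indexed_graph.below (contraction G F) d e"
    "indexed_graph.below (contraction G F) d f" "k \<le> index (contraction G F) d"
    using indexed_graph.common_below[OF indexed_graph_contraction, of e k f "super x" "super y"]
      assms(1,2) by (auto simp: contraction_light)
  then show ?thesis
    using indexed_graph.belowD[OF indexed_graph_contraction d(1)] by (auto simp: contraction_def)
qed

text \<open>Apply \<open>contraction_common_below\<close> to \<open>a\<close> and \<open>e\<close>
  at the index of \<open>a\<close>: the common ancestor found is an ancestor of \<open>a\<close> and
  no heavier than \<open>a\<close>, so it is \<open>a\<close>.\<close>

lemma contraction_belowI:
  assumes "below a e" "a \<in> F" "e \<in> F"
  shows "indexed_graph.below (contraction G F) a e"
proof -
  let ?k = "index G a"
  obtain x y where xy: "x \<in> ends G a" "y \<in> ends G e"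
    using assms(1) ends_nonempty belowD by meson
  then have "(x, y) \<in> reach (ends G) (light ?k)" using below_reach[OF assms(1)] by simp
  then have "(x, y) \<in> reach (ends G) (F \<inter> light ?k \<union> (edges G - F))"
    by (rule reach_mono) (auto simp: light_def)
  moreover have "a \<in> F \<inter> light ?k" "e \<in> F \<inter> light ?k"
    using assms belowD[OF assms(1)] by (auto simp: light_def)
  ultimately obtain d where d: "indexed_graph.below (contraction G F) d a"
    "indexed_graph.below (contraction G F) d e" "?k \<le> index G d"
    using contraction_common_below xy by blast
  have "d = a"
    using indexed_graph.belowD[OF indexed_graph_contraction d(1)] d(3) F
    by (intro index_eqD) (auto simp: contraction_def)
  then show ?thesis using d by simp
qed

section \<open>The two implications\<close>

lemma LCDA_in_if_lineage:
  assumes lineage: "\<And>a e. a \<in> F \<Longrightarrow> e \<in> F \<Longrightarrow>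
      indexed_graph.below (contraction G F) a e \<Longrightarrow> below a e"
    and e: "e \<in> F" and f: "f \<in> F"
  shows "LCDA G e f \<in> F"
proof -
  define c where "c = LCDA G e f"
  have ef: "e \<in> edges G" "f \<in> edges G" using e f F by auto
  note c = LCDA_below[OF ef, folded c_def]
  obtain x y z where xyz: "x \<in> ends G c" "y \<in> ends G e" "z \<in> ends G f"
    using c(1,2) ends_nonempty belowD by meson
  then have "(y, z) \<in> reach (ends G) (light (index G c))"
    using below_reach[OF c(1)] below_reach[OF c(2)] by (blast intro: reach_trans reach_sym order_refl)
  then have "(y, z) \<in> reach (ends G) (F \<inter> light (index G c) \<union> (edges G - F))"
    by (rule reach_mono) (auto simp: light_def)
  moreover have "e \<in> F \<inter> light (index G c)" "f \<in> F \<inter> light (index G c)"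
    using e f belowD[OF c(1)] belowD[OF c(2)] by (auto simp: light_def)
  ultimately obtain d where d: "d \<in> F" "indexed_graph.below (contraction G F) d e"
    "indexed_graph.below (contraction G F) d f" "index G c \<le> index G d"
    using contraction_common_below xyz by blast
  then have "below d c" using lineage e f c(3) by blast
  \<comment> \<open>An ancestor of \<open>c\<close> has index at most that of \<open>c\<close>,
    while \<open>d\<close> was found among the edges of index at least that.\<close>
  then have "d = c" using d(4) belowD[of d c] by (intro index_eqD) auto
  then show ?thesis using d(1) c_def by simp
qed

lemma lineage_if_LCDA_in:
  assumes bridge: "\<And>c x y. c \<in> edges G \<Longrightarrow> ends G c = {x, y} \<Longrightarrow>
      (x, y) \<notin> reach (ends G) (edges G - {c})"
    and a: "a \<in> F" and e: "e \<in> F" and LCDA: "LCDA G a e \<in> F"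
    and b: "indexed_graph.below (contraction G F) a e"
  shows "below a e"
proof (rule ccontr)
  assume not_below: "\<not> below a e"
  define c where "c = LCDA G a e"
  have ae: "a \<in> edges G" "e \<in> edges G" using a e F by auto
  note c = LCDA_below[OF ae, folded c_def]
  have c_in: "c \<in> edges G" using c(1) belowD by blast
  have "index G a \<le> index G e"
    using indexed_graph.belowD[OF indexed_graph_contraction b] by (simp add: contraction_def)
  \<comment> \<open>Equality would give \<open>c = a\<close>, making \<open>a\<close> an ancestor of
    \<open>e\<close>.\<close>
  moreover have "index G c \<noteq> index G a"
    using not_below c(2) index_eqD[OF c_in ae(1)] by auto
  ultimately have less: "index G c < index G a" "index G c < index G e"
    using belowD[OF c(1)] by auto
  \<comment> \<open>The edges strictly lighter than \<open>c\<close>; by injectivity of the index,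
    only \<open>c\<close> is lost from \<open>light (index G c)\<close>.\<close>
  let ?L = "light (Suc (index G c))"
  have L: "light (index G c) - {c} = ?L"
    using index_eqD[OF c_in] by (auto simp: light_def Suc_le_eq le_less)
  have L_sub: "?L \<subseteq> edges G - {c}" by (auto simp: light_def)
  obtain x y where xy: "ends G c = {x, y}" using ends_pair c_in by blast
  obtain p q where pq: "p \<in> ends G a" "q \<in> ends G e" using ae ends_nonempty by blast
  have near: "(r, x) \<in> reach (ends G) ?L \<or> (r, y) \<in> reach (ends G) ?L"
    if "below c g" "r \<in> ends G g" for g r
  proof -
    have "(r, x) \<in> reach (ends G) (light (index G c))"
      using below_reach[OF that(1), of x r] that(2) xy by (auto intro: reach_sym)
    from reach_remove_edge[where en = "ends G" and c = c, OF this xy] show ?thesis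
      unfolding L by blast
  qed
  \<comment> \<open>Otherwise \<open>common_below\<close> would yield a common ancestor strictly
    lighter than \<open>c\<close>.\<close>
  have apart: "(p, q) \<notin> reach (ends G) ?L"
  proof
    assume "(p, q) \<in> reach (ends G) ?L"
    moreover have "a \<in> ?L" "e \<in> ?L" using ae less by (auto simp: light_def)
    ultimately obtain d where "below d a" "below d e" "Suc (index G c) \<le> index G d"
      using common_below pq by blast
    then show False using c(3)[of d] belowD[of d c] by auto
  qed
  \<comment> \<open>Each of \<open>p\<close> and \<open>q\<close> is joined to an end of
    \<open>c\<close>, and being apart they are joined to different ends.\<close>
  have "(p, x) \<in> reach (ends G) ?L \<and> (q, y) \<in> reach (ends G) ?L \<or>
    (p, y) \<in> reach (ends G) ?L \<and> (q, x) \<in> reach (ends G) ?L"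
    using near[OF c(1) pq(1)] near[OF c(2) pq(2)] apart by (blast intro: reach_trans reach_sym)
  moreover have "reach (ends G) ?L \<subseteq> reach (ends G) (edges G - {c})"
    using reach_mono[OF _ L_sub] by auto
  ultimately have ends_c:
    "(p, x) \<in> reach (ends G) (edges G - {c}) \<and> (q, y) \<in> reach (ends G) (edges G - {c}) \<or>
     (p, y) \<in> reach (ends G) (edges G - {c}) \<and> (q, x) \<in> reach (ends G) (edges G - {c})"
    by blast
  \<comment> \<open>The witnessing edges are either contracted, while \<open>c\<close> is kept, or
    no heavier than \<open>a\<close>, while \<open>c\<close> is heavier.\<close>
  have "(p, q) \<in> reach (ends G) (edges G - {c})"
    using contraction_belowD[OF b pq]
    by (rule reach_mono) (use F LCDA less in \<open>auto simp: light_def c_def\<close>)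
  then have "(x, y) \<in> reach (ends G) (edges G - {c})"
    using ends_c by (blast intro: reach_trans reach_sym)
  then show False using bridge[OF c_in xy] by blast
qed

end

end

theorem theorem3:
  fixes T :: "('v, 'e) wgraph" and E\<^sub>c :: "'e set"
  assumes "weighted_tree T" and "E\<^sub>c \<subseteq> edges T"
  shows "lineage_preserving_contraction T (contraction T E\<^sub>c) \<longleftrightarrow>
    (\<forall>e\<^sub>i\<in>E\<^sub>c. \<forall>e\<^sub>j\<in>E\<^sub>c. LCDA T e\<^sub>i e\<^sub>j \<in> E\<^sub>c)"
proof -
  interpret T: indexed_graph T by (rule tree_indexed_graph) fact
  note F = \<open>E\<^sub>c \<subseteq> edges T\<close>
  let ?C = "contraction T E\<^sub>c"
  have bridge: "\<And>c x y. c \<in> edges T \<Longrightarrow> ends T c = {x, y} \<Longrightarrow>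
      (x, y) \<notin> reach (ends T) (edges T - {c})"
    using tree_bridge[of T] assms(1) by (simp add: weighted_tree_def)
  \<comment> \<open>The existential in the definition is witnessed by \<open>E\<^sub>c\<close>
    itself; both ancestor relations are then replaced by \<open>below\<close>.\<close>
  have "lineage_preserving_contraction T ?C \<longleftrightarrow>
    (\<forall>e\<in>E\<^sub>c. \<forall>f\<in>E\<^sub>c. indexed_graph.below ?C e f \<longleftrightarrow> T.below e f)"
    using F T.ancestor_iff_below
      indexed_graph.ancestor_iff_below[OF T.indexed_graph_contraction[OF F]]
    by (auto simp: lineage_preserving_contraction_def contraction_def)
  also have "\<dots> \<longleftrightarrow> (\<forall>e\<in>E\<^sub>c. \<forall>f\<in>E\<^sub>c. LCDA T e f \<in> E\<^sub>c)"
  proof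
    assume "\<forall>e\<in>E\<^sub>c. \<forall>f\<in>E\<^sub>c. indexed_graph.below ?C e f \<longleftrightarrow> T.below e f"
    then show "\<forall>e\<in>E\<^sub>c. \<forall>f\<in>E\<^sub>c. LCDA T e f \<in> E\<^sub>c"
      by (auto intro!: T.LCDA_in_if_lineage[OF F])
  next
    assume "\<forall>e\<in>E\<^sub>c. \<forall>f\<in>E\<^sub>c. LCDA T e f \<in> E\<^sub>c"
    then show "\<forall>e\<in>E\<^sub>c. \<forall>f\<in>E\<^sub>c. indexed_graph.below ?C e f \<longleftrightarrow> T.below e f"
      by (auto intro: T.lineage_if_LCDA_in[OF F bridge] T.contraction_belowI[OF F])
  qed
  finally show ?thesis .
qed

end
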